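(* Every graphical isotropic minimal surface can be decomposed into an infinite sum of scaled isotropic generalised Enneper surfaces and two planar minimal surfaces, one of which is parallel to the $xy$-plane.
   Context: Isotropic $3$-space $\mathbb I^3$ is $\mathbb R^3$ with the degenerate metric $dx^2+dy^2$; a graph $(x,y,h(x,y))$ is an isotropic minimal surface if and only if $\Delta h=0$. Decomposition refers to writing the height function as a sum of height functions, through the power series expansion $h(x,y)=\sum_{n=0}^\infty(c_nz^n+\overline{c_n}\,\bar z^n)$, $z=x+iy$, of the harmonic function $h$. Isotropic minimal surfaces have the Weierstrass–Enneper type representation $\operatorname{Re}\int^z(F,-iF,2FG)\,dw$ with Weierstrass data $(F,G)$. For $n>1$, the isotropic minimal surface with height function $c_nz^n+\overline{c_n}\,\bar z^n$ has Weierstrass data $(1,az^{n-1})$ with $a=nc_n$, and is called a scaled isotropic generalised Enneper surface of order $n-1$. For $n=0$ the corresponding surface is a plane parallel to the $xy$-plane, and for $n=1$ it is a plane not necessarily parallel to the $xy$-plane.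
   Formalization: For a graph over a general domain the decomposition is claimed on each disc about a chosen centre inside the domain, with the summands translated to that centre, since one power series need not converge on the whole domain; graphs over the plane or a disc are covered entirely. *)

theory Defs
  imports "HOL-Complex_Analysis.Complex_Analysis"
begin

no_notation fps_nth (infixl "$" 75)

text \<open>
  The parameter domain of a surface is a subset of \<^typ>\<open>complex\<close>, with \<open>u + i v\<close> standing for the
  parameter pair \<open>(u, v)\<close>; isotropic 3-space is \<^typ>\<open>real^3\<close> with the degenerate scalar product
  \<open>iso_inner\<close>. Partial derivatives are taken in the directions \<^term>\<open>1 :: complex\<close> (for \<open>u\<close>)
  and \<^term>\<open>\<i>\<close> (for \<open>v\<close>).
\<close>

definition partial :: "complex \<Rightarrow> (complex \<Rightarrow> 'a::real_normed_vector) \<Rightarrow> complex \<Rightarrow> 'a" where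
  "partial d f z = vector_derivative (\<lambda>t::real. f (z + of_real t * d)) (at 0)"

definition C1_on :: "(complex \<Rightarrow> 'a::real_normed_vector) \<Rightarrow> complex set \<Rightarrow> bool" where
  "C1_on f U \<longleftrightarrow> (\<forall>d\<in>{1, \<i>}.
     (\<forall>z\<in>U. (\<lambda>t::real. f (z + of_real t * d)) differentiable (at 0)) \<and>
     continuous_on U (partial d f))"

definition C2_on :: "(complex \<Rightarrow> 'a::real_normed_vector) \<Rightarrow> complex set \<Rightarrow> bool" where
  "C2_on f U \<longleftrightarrow> C1_on f U \<and> (\<forall>d\<in>{1, \<i>}. C1_on (partial d f) U)"

definition laplacian :: "(complex \<Rightarrow> real) \<Rightarrow> complex \<Rightarrow> real" where
  "laplacian h z = partial 1 (partial 1 h) z + partial \<i> (partial \<i> h) z"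

definition iso_inner :: "real^3 \<Rightarrow> real^3 \<Rightarrow> real" where
  "iso_inner p q = p $ 1 * q $ 1 + p $ 2 * q $ 2"

text \<open>The discriminant \<open>E G - F\<^sup>2\<close> of the first fundamental form of isotropic space.\<close>

definition iso_disc :: "(complex \<Rightarrow> real^3) \<Rightarrow> complex \<Rightarrow> real" where
  "iso_disc X z =
     iso_inner (partial 1 X z) (partial 1 X z) * iso_inner (partial \<i> X z) (partial \<i> X z)
     - (iso_inner (partial 1 X z) (partial \<i> X z))\<^sup>2"

text \<open>
  The coefficients \<open>L, M, N\<close> of the isotropic second fundamental form, for \<open>(d, e)\<close> equal to
  \<open>(1, 1)\<close>, \<open>(1, \<i>)\<close> and \<open>(\<i>, \<i>)\<close> respectively:
  \<open>det (X\<^sub>u, X\<^sub>v, X\<^sub>d\<^sub>e) / sqrt (E G - F\<^sup>2)\<close>.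
\<close>

definition iso_second_form :: "complex \<Rightarrow> complex \<Rightarrow> (complex \<Rightarrow> real^3) \<Rightarrow> complex \<Rightarrow> real" where
  "iso_second_form d e X z =
     det (vector [partial 1 X z, partial \<i> X z, partial e (partial d X) z] :: real^3^3)
     / sqrt (iso_disc X z)"

text \<open>\<open>(E N - 2 F M + G L) / (2 (E G - F\<^sup>2))\<close>\<close>

definition iso_mean_curvature :: "(complex \<Rightarrow> real^3) \<Rightarrow> complex \<Rightarrow> real" where
  "iso_mean_curvature X z =
     (iso_inner (partial 1 X z) (partial 1 X z) * iso_second_form \<i> \<i> X z
      - 2 * iso_inner (partial 1 X z) (partial \<i> X z) * iso_second_form 1 \<i> X z
      + iso_inner (partial \<i> X z) (partial \<i> X z) * iso_second_form 1 1 X z)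
     / (2 * iso_disc X z)"

text \<open>
  The condition \<open>iso_disc X z > 0\<close> says that the surface is immersed without tangent planes
  parallel to the z-axis (admissibility); graphs satisfy it automatically.
\<close>

definition isotropic_minimal_surface :: "(complex \<Rightarrow> real^3) \<Rightarrow> complex set \<Rightarrow> bool" where
  "isotropic_minimal_surface X U \<longleftrightarrow>
     open U \<and> C2_on X U \<and> (\<forall>z\<in>U. iso_disc X z > 0 \<and> iso_mean_curvature X z = 0)"

definition graph_surface :: "(complex \<Rightarrow> real) \<Rightarrow> complex \<Rightarrow> real^3" where
  "graph_surface h z = vector [Re z, Im z, h z]"

definition planar_minimal_surface :: "(complex \<Rightarrow> real^3) \<Rightarrow> bool" where
  "planar_minimal_surface X \<longleftrightarrow>
     isotropic_minimal_surface X UNIV \<and> (\<exists>n d. n \<noteq> 0 \<and> range X = {p. n \<bullet> p = d})"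

definition parallel_to_xy_plane :: "(complex \<Rightarrow> real^3) \<Rightarrow> bool" where
  "parallel_to_xy_plane X \<longleftrightarrow> (\<exists>d. range X = {p. p $ 3 = d})"

text \<open>
  The surface \<open>Re \<integral> (F, -iF, 2FG) dw\<close> with Weierstrass data \<open>(F, G)\<close>, normalised to vanish at the
  origin. The integral runs along the segment from \<open>0\<close> to \<open>z\<close>, which suffices for entire data.
\<close>

definition weierstrass_enneper ::
    "(complex \<Rightarrow> complex) \<Rightarrow> (complex \<Rightarrow> complex) \<Rightarrow> complex \<Rightarrow> real^3" where
  "weierstrass_enneper F G z = vector
     [Re (contour_integral (linepath 0 z) F),
      Re (contour_integral (linepath 0 z) (\<lambda>w. - \<i> * F w)),
      Re (contour_integral (linepath 0 z) (\<lambda>w. 2 * F w * G w))]"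

definition scaled_isotropic_enneper :: "nat \<Rightarrow> complex \<Rightarrow> complex \<Rightarrow> real^3" where
  "scaled_isotropic_enneper m a = weierstrass_enneper (\<lambda>w. 1) (\<lambda>w. a * w ^ m)"

text \<open>The number \<open>c z\<^sup>n + cnj c (cnj z)\<^sup>n\<close> is real; \<^const>\<open>Re\<close> only changes its type.\<close>

definition term_surface :: "nat \<Rightarrow> complex \<Rightarrow> complex \<Rightarrow> real^3" where
  "term_surface n c = graph_surface (\<lambda>z. Re (c * z ^ n + cnj c * cnj z ^ n))"

text \<open>
  The surface \<open>X\<close>, given over the \<open>xy\<close>-plane, moved by the horizontal translation that takes the
  origin to \<open>(Re z0, Im z0, 0)\<close>; it is again given over the \<open>xy\<close>-plane.
\<close>

definition translate_surface :: "complex \<Rightarrow> (complex \<Rightarrow> real^3) \<Rightarrow> complex \<Rightarrow> real^3" where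
  "translate_surface z0 X z = X (z - z0) + vector [Re z0, Im z0, 0]"

text \<open>
  Decomposition adds heights only: over each point of the base domain \<open>D\<close> the height of \<open>X\<close> is the
  sum of the heights of the \<open>S n\<close>. All surfaces are required to be graphs over \<open>D\<close>.
\<close>

definition decomposes_on ::
    "complex set \<Rightarrow> (complex \<Rightarrow> real^3) \<Rightarrow> (nat \<Rightarrow> complex \<Rightarrow> real^3) \<Rightarrow> bool" where
  "decomposes_on D X S \<longleftrightarrow> (\<exists>h H. \<forall>z\<in>D. X z = graph_surface h z \<and>
     (\<forall>n. S n z = graph_surface (H n) z) \<and> (\<lambda>n. H n z) sums h z)"

lemma vector3_eq:
  "(vector [a, b, c] :: real^3) = a *\<^sub>R axis 1 1 + b *\<^sub>R axis 2 1 + c *\<^sub>R axis 3 1"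
  by (simp add: vec_eq_iff forall_3 axis_def)

lemma vector3_has_vector_derivative:
  assumes "(f has_vector_derivative f') (at t)" "(g has_vector_derivative g') (at t)"
    "(k has_vector_derivative k') (at t)"
  shows "((\<lambda>t. vector [f t, g t, k t] :: real^3) has_vector_derivative vector [f', g', k']) (at t)"
proof -
  have sc: "((\<lambda>t. f t *\<^sub>R v) has_vector_derivative f' *\<^sub>R v) (at t)"
    if "(f has_vector_derivative f') (at t)" for f :: "real \<Rightarrow> real" and f' and v :: "real^3"
    using bounded_linear.has_vector_derivative[OF bounded_linear_scaleR_left that] .
  show ?thesis unfolding vector3_eq
    by (intro has_vector_derivative_add sc assms)
qed

lemma nth_has_vector_derivative:
  fixes f :: "real \<Rightarrow> real^3"
  assumes "(f has_vector_derivative f') F"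
  shows "((\<lambda>t. f t $ i) has_vector_derivative f' $ i) F"
  using bounded_linear.has_vector_derivative[OF bounded_linear_vec_nth assms] .

lemma partial_eqI:
  "((\<lambda>t::real. f (z + of_real t * d)) has_vector_derivative D) (at 0) \<Longrightarrow> partial d f z = D"
  unfolding partial_def by (rule vector_derivative_at)

lemma vector3_partial:
  fixes f g k :: "complex \<Rightarrow> real"
  assumes "(\<lambda>t::real. f (z + of_real t * d)) differentiable (at 0)"
    "(\<lambda>t::real. g (z + of_real t * d)) differentiable (at 0)"
    "(\<lambda>t::real. k (z + of_real t * d)) differentiable (at 0)"
  shows "partial d (\<lambda>z. vector [f z, g z, k z] :: real^3) z =
      vector [partial d f z, partial d g z, partial d k z]"
    "(\<lambda>t::real. vector [f (z + of_real t * d), g (z + of_real t * d), k (z + of_real t * d)] :: real^3)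
      differentiable (at 0)"
proof -
  have *: "((\<lambda>t::real. vector [f (z + of_real t * d), g (z + of_real t * d), k (z + of_real t * d)] :: real^3)
    has_vector_derivative vector [partial d f z, partial d g z, partial d k z]) (at 0)"
    using assms unfolding partial_def vector_derivative_works
    by (rule vector3_has_vector_derivative)
  show "partial d (\<lambda>z. vector [f z, g z, k z] :: real^3) z =
      vector [partial d f z, partial d g z, partial d k z]"
    using * by (rule partial_eqI)
  show "(\<lambda>t::real. vector [f (z + of_real t * d), g (z + of_real t * d), k (z + of_real t * d)] :: real^3)
      differentiable (at 0)"
    using * by (rule differentiableI_vector)
qed

lemma partial_Re [simp]: "partial d Re z = Re d"
  and partial_Im [simp]: "partial d Im z = Im d"
  and diff_Re: "(\<lambda>t::real. Re (z + of_real t * d)) differentiable (at 0)"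
  and diff_Im: "(\<lambda>t::real. Im (z + of_real t * d)) differentiable (at 0)"
proof -
  have 1: "((\<lambda>t::real. Re (z + of_real t * d)) has_vector_derivative Re d) (at 0)"
    by (auto intro!: derivative_eq_intros simp: has_real_derivative_iff_has_vector_derivative[symmetric])
  have 2: "((\<lambda>t::real. Im (z + of_real t * d)) has_vector_derivative Im d) (at 0)"
    by (auto intro!: derivative_eq_intros simp: has_real_derivative_iff_has_vector_derivative[symmetric])
  show "partial d Re z = Re d" using 1 by (rule partial_eqI)
  show "partial d Im z = Im d" using 2 by (rule partial_eqI)
  show "(\<lambda>t::real. Re (z + of_real t * d)) differentiable (at 0)"
    using 1 by (rule differentiableI_vector)
  show "(\<lambda>t::real. Im (z + of_real t * d)) differentiable (at 0)"
    using 2 by (rule differentiableI_vector)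
qed

lemma partial_cong_open:
  assumes "open U" "z \<in> U" "\<And>w. w \<in> U \<Longrightarrow> f w = g w"
  shows "partial d f z = partial d g z"
    "(\<lambda>t::real. f (z + of_real t * d)) differentiable (at 0) \<longleftrightarrow>
     (\<lambda>t::real. g (z + of_real t * d)) differentiable (at 0)"
proof -
  have op: "open ((\<lambda>t::real. z + of_real t * d) -` U)"
    by (rule continuous_open_vimage[OF assms(1)]) (intro continuous_intros)
  have ev: "eventually (\<lambda>t::real. f (z + of_real t * d) = g (z + of_real t * d)) (nhds 0)"
    unfolding eventually_nhds by (intro exI[of _ "(\<lambda>t::real. z + of_real t * d) -` U"])
      (use op assms in auto)
  then have D: "((\<lambda>t::real. f (z + of_real t * d)) has_vector_derivative D) (at 0) \<longleftrightarrow>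
      ((\<lambda>t::real. g (z + of_real t * d)) has_vector_derivative D) (at 0)" for D
    using assms(2,3) by (intro has_vector_derivative_cong_ev) (auto elim: eventually_mono)
  show "partial d f z = partial d g z"
    unfolding partial_def vector_derivative_def D ..
  show "(\<lambda>t::real. f (z + of_real t * d)) differentiable (at 0) \<longleftrightarrow>
     (\<lambda>t::real. g (z + of_real t * d)) differentiable (at 0)"
    using D by (metis differentiableI_vector vector_derivative_works)
qed

lemma C1_on_cong:
  assumes "open U" "\<And>w. w \<in> U \<Longrightarrow> f w = g w"
  shows "C1_on f U \<longleftrightarrow> C1_on g U"
proof -
  note c = partial_cong_open[where f = f and g = g, OF assms(1) _ assms(2)]
  have "continuous_on U (partial d f) \<longleftrightarrow> continuous_on U (partial d g)" for d
    by (intro continuous_on_cong refl c(1))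
  then show ?thesis unfolding C1_on_def using c(2) by blast
qed

lemma C1_on_vector3:
  fixes f g k :: "complex \<Rightarrow> real"
  assumes "C1_on f U" "C1_on g U"
  shows "C1_on (\<lambda>z. vector [f z, g z, k z] :: real^3) U \<longleftrightarrow> C1_on k U"
proof
  assume k: "C1_on k U"
  show "C1_on (\<lambda>z. vector [f z, g z, k z] :: real^3) U"
    unfolding C1_on_def
  proof (intro ballI conjI)
    fix d z assume d: "d \<in> {1, \<i>}" and z: "z \<in> U"
    show "(\<lambda>t::real. vector [f (z + of_real t * d), g (z + of_real t * d), k (z + of_real t * d)] :: real^3)
      differentiable (at 0)"
      using assms k d z unfolding C1_on_def by (intro vector3_partial(2)) blast+
  next
    fix d assume d: "d \<in> {1, \<i>}"
    have "continuous_on U (\<lambda>z. vector [partial d f z, partial d g z, partial d k z] :: real^3)"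
      unfolding vector3_eq
      by (intro continuous_intros) (use assms k d in \<open>auto simp: C1_on_def\<close>)
    then show "continuous_on U (partial d (\<lambda>z. vector [f z, g z, k z] :: real^3))"
      by (rule continuous_on_eq, subst vector3_partial(1))
        (use assms k d in \<open>auto simp: C1_on_def\<close>)
  qed
next
  assume v: "C1_on (\<lambda>z. vector [f z, g z, k z] :: real^3) U"
  have hv: "((\<lambda>t::real. k (z + of_real t * d)) has_vector_derivative
      partial d (\<lambda>z. vector [f z, g z, k z] :: real^3) z $ 3) (at 0)"
    if "d \<in> {1, \<i>}" "z \<in> U" for d z
  proof -
    have "(\<lambda>t::real. vector [f (z + of_real t * d), g (z + of_real t * d), k (z + of_real t * d)] :: real^3)
        differentiable (at 0)"
      using v that unfolding C1_on_def by blast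
    then have "((\<lambda>t::real. vector [f (z + of_real t * d), g (z + of_real t * d), k (z + of_real t * d)] :: real^3)
        has_vector_derivative partial d (\<lambda>z. vector [f z, g z, k z] :: real^3) z) (at 0)"
      unfolding partial_def vector_derivative_works .
    from nth_has_vector_derivative[OF this, of 3] show ?thesis
      by (simp)
  qed
  show "C1_on k U"
    unfolding C1_on_def
  proof (intro ballI conjI)
    fix d z assume "d \<in> {1, \<i>}" "z \<in> U"
    then show "(\<lambda>t::real. k (z + of_real t * d)) differentiable (at 0)"
      using hv differentiableI_vector by blast
  next
    fix d assume d: "d \<in> {1, \<i>}"
    then have "continuous_on U (\<lambda>z. partial d (\<lambda>z. vector [f z, g z, k z] :: real^3) z $ 3)"
      using v unfolding C1_on_def by (intro continuous_intros) auto
    then show "continuous_on U (partial d k)"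
      by (rule continuous_on_eq) (simp add: partial_eqI[OF hv[OF d]])
  qed
qed

lemma C1_on_const: "C1_on (\<lambda>z. c) U"
  by (auto simp: C1_on_def partial_def)

lemma C1_on_Re: "C1_on Re U" and C1_on_Im: "C1_on Im U"
  using diff_Re diff_Im by (auto simp: C1_on_def cong: continuous_on_cong)

lemma partial_graph_surface:
  assumes "C1_on h U" "z \<in> U" "d \<in> {1, \<i>}"
  shows "partial d (graph_surface h) z = vector [Re d, Im d, partial d h z]"
proof -
  have "(\<lambda>t::real. h (z + of_real t * d)) differentiable (at 0)"
    using assms unfolding C1_on_def by blast
  from vector3_partial(1)[OF diff_Re diff_Im this] show ?thesis
    by (simp add: graph_surface_def[abs_def])
qed

lemma C2_on_graph_surface:
  assumes "open U"
  shows "C2_on (graph_surface h) U \<longleftrightarrow> C2_on h U"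
proof -
  have 1: "C1_on (graph_surface h) U \<longleftrightarrow> C1_on h U"
    unfolding graph_surface_def[abs_def] by (rule C1_on_vector3[OF C1_on_Re C1_on_Im])
  have 2: "C1_on (partial d (graph_surface h)) U \<longleftrightarrow> C1_on (partial d h) U"
    if "C1_on h U" "d \<in> {1, \<i>}" for d
  proof -
    have "C1_on (partial d (graph_surface h)) U \<longleftrightarrow>
        C1_on (\<lambda>z. vector [Re d, Im d, partial d h z] :: real^3) U"
      by (rule C1_on_cong[OF assms partial_graph_surface[OF that(1) _ that(2)]])
    also have "\<dots> \<longleftrightarrow> C1_on (partial d h) U"
      by (rule C1_on_vector3[OF C1_on_const C1_on_const])
    finally show ?thesis .
  qed
  show ?thesis unfolding C2_on_def using 1 2 by blast
qed

lemma partial2_graph_surface: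
  assumes "open U" "C2_on h U" "z \<in> U" "d \<in> {1, \<i>}" "e \<in> {1, \<i>}"
  shows "partial e (partial d (graph_surface h)) z = vector [0, 0, partial e (partial d h) z]"
proof -
  have "partial e (partial d (graph_surface h)) z =
      partial e (\<lambda>z. vector [Re d, Im d, partial d h z]) z"
    by (rule partial_cong_open[OF assms(1,3)])
      (use partial_graph_surface assms in \<open>auto simp: C2_on_def\<close>)
  also have "\<dots> = vector [partial e (\<lambda>_. Re d) z, partial e (\<lambda>_. Im d) z, partial e (partial d h) z]"
    by (rule vector3_partial(1)) (use assms in \<open>auto simp: C2_on_def C1_on_def\<close>)
  finally show ?thesis by (simp add: partial_def)
qed

text \<open>For graphs, vanishing isotropic mean curvature is harmonicity of the height function.\<close>

theorem isotropic_minimal_graph_iff: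
  "isotropic_minimal_surface (graph_surface h) U \<longleftrightarrow>
     open U \<and> C2_on h U \<and> (\<forall>z\<in>U. laplacian h z = 0)"
proof -
  have "iso_disc (graph_surface h) z = 1 \<and> iso_mean_curvature (graph_surface h) z = laplacian h z / 2"
    if "open U" "C2_on h U" "z \<in> U" for z
  proof -
    have C1: "C1_on h U" using that by (simp add: C2_on_def)
    note p = partial_graph_surface[OF C1 that(3)] partial2_graph_surface[OF that]
    have d: "iso_disc (graph_surface h) z = 1"
      by (simp add: iso_disc_def iso_inner_def p)
    show ?thesis
      by (simp add: d iso_mean_curvature_def iso_second_form_def laplacian_def iso_inner_def
          p det_3)
  qed
  then show ?thesis
    unfolding isotropic_minimal_surface_def using C2_on_graph_surface by force
qed

end

theory Submission
  imports Defs
begin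

text \<open>
  Vanishing isotropic mean curvature says that the height \<open>h\<close> is harmonic, so \<open>h\<^sub>x - \<i> h\<^sub>y\<close>
  satisfies the Cauchy-Riemann equations on \<open>U\<close>. A primitive on a ball around \<open>z0\<close>, normalised to
  the value \<open>h z0\<close> at \<open>z0\<close>, has real part \<open>h\<close> there; its Taylor coefficients, halved, are the
  \<open>c\<^sub>n\<close>. They do not depend on the ball, since up to a factor they are derivatives at \<open>z0\<close>
  of \<open>h\<^sub>x - \<i> h\<^sub>y\<close>.
\<close>

section \<open>Calculus of partial derivatives\<close>

text \<open>\<open>partial\<close> is a derivative at parameter 0 only. Composing with the shift
  \<open>t - s\<close> moves it to any parameter \<open>s\<close> on the line through
  \<open>z\<close> with direction \<open>d\<close>, in the form that the mean value theorem and
  \<open>has_derivative_partialsI\<close> ask for.\<close>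

lemma has_vector_derivative_partial:
  assumes "(\<lambda>t::real. f (z + of_real s * d + of_real t * d)) differentiable (at 0)"
  shows "((\<lambda>t::real. f (z + of_real t * d)) has_vector_derivative
           partial d f (z + of_real s * d)) (at s within T)"
proof -
  have "((\<lambda>t::real. f (z + of_real s * d + of_real t * d)) has_vector_derivative
           partial d f (z + of_real s * d)) (at (s - s))"
    using assms unfolding partial_def vector_derivative_works by simp
  moreover have "((\<lambda>t. t - s) has_vector_derivative 1) (at s)"
    by (auto intro!: derivative_eq_intros)
  ultimately have "((\<lambda>t::real. f (z + of_real s * d + of_real t * d)) \<circ> (\<lambda>t. t - s)
      has_vector_derivative 1 *\<^sub>R partial d f (z + of_real s * d)) (at s)"
    by (intro vector_diff_chain_at) auto
  then have "((\<lambda>t::real. f (z + of_real t * d)) has_vector_derivative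
           partial d f (z + of_real s * d)) (at s)"
    by (simp add: o_def algebra_simps)
  then show ?thesis
    by (rule has_vector_derivative_at_within)
qed

lemma C1_on_has_vector_derivative:
  assumes "C1_on f U" "d \<in> {1, \<i>}" "z + of_real s * d \<in> U"
  shows "((\<lambda>t::real. f (z + of_real t * d)) has_vector_derivative
           partial d f (z + of_real s * d)) (at s within T)"
  using assms unfolding C1_on_def by (intro has_vector_derivative_partial) blast

text \<open>The classical criterion: continuous partial derivatives give a total derivative. It is
  proved for pairs of reals by \<open>has_derivative_partialsI\<close> and carried over to
  \<open>complex\<close> by composing with \<open>w \<mapsto> (Re w, Im w)\<close>.\<close>

lemma C1_on_has_derivative:
  fixes f :: "complex \<Rightarrow> 'a::real_normed_vector"
  assumes "open U" "C1_on f U" "z \<in> U"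
  shows "(f has_derivative (\<lambda>v. Re v *\<^sub>R partial 1 f z + Im v *\<^sub>R partial \<i> f z)) (at z)"
proof -
  define P where "P = (\<lambda>xy. Complex (fst xy) (snd xy))"
  have P_alt: "P = (\<lambda>xy. of_real (fst xy) + \<i> * of_real (snd xy))"
    by (auto simp: P_def fun_eq_iff complex_eq_iff)
  have contP: "continuous_on S P" for S
    unfolding P_alt by (intro continuous_intros)
  have "open (P -` U)"
    using open_vimage[OF assms(1) contP] .
  moreover have "(Re z, Im z) \<in> P -` U"
    using assms(3) by (simp add: P_def)
  ultimately obtain X Y where XY: "open X" "open Y" "(Re z, Im z) \<in> X \<times> Y" "X \<times> Y \<subseteq> P -` U"
    by (rule open_prod_elim)
  then have "Im z \<in> Y" by simp
  with \<open>open Y\<close> obtain e where e: "e > 0" "ball (Im z) e \<subseteq> Y"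
    by (rule openE)
  \<comment> \<open>The second factor of the product neighbourhood must be convex, so it is shrunk
    to a ball; the first one only has to be open.\<close>
  define Y' where "Y' = ball (Im z) e"
  have inU: "Complex x y \<in> U" if "x \<in> X" "y \<in> Y'" for x y
    using subsetD[OF XY(4), of "(x, y)"] subsetD[OF e(2), of y] that by (simp add: Y'_def P_def)
  have opn: "open (X \<times> Y')" and z: "(Re z, Im z) \<in> X \<times> Y'"
    using XY e by (auto simp: Y'_def open_Times)
  define F where "F = (\<lambda>x y. f (Complex x y))"
  have "((\<lambda>(x, y). F x y) has_derivative
          (\<lambda>(tx, ty). tx *\<^sub>R partial 1 f z
             + blinfun_scaleR_left (partial \<i> f (Complex (Re z) (Im z))) ty))
        (at (Re z, Im z) within X \<times> Y')"
  proof (rule has_derivative_partialsI)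
    have "\<i> * of_real (Im z) + of_real t * 1 = Complex t (Im z)" for t
      by (simp add: complex_eq_iff)
    then show "((\<lambda>x. F x (Im z)) has_derivative (\<lambda>tx. tx *\<^sub>R partial 1 f z)) (at (Re z) within X)"
      using C1_on_has_vector_derivative[OF assms(2), of 1 "\<i> * of_real (Im z)" "Re z" X] assms(3)
      by (simp add: F_def has_vector_derivative_def)
  next
    fix x y assume xy: "x \<in> X" "y \<in> Y'"
    have "of_real x + of_real t * \<i> = Complex x t" for t
      by (simp add: complex_eq_iff)
    then show "((\<lambda>y. F x y) has_derivative
        blinfun_apply (blinfun_scaleR_left (partial \<i> f (Complex x y)))) (at y within Y')"
      using C1_on_has_vector_derivative[OF assms(2), of \<i> "of_real x" y Y'] inU[OF xy]
      by (simp add: F_def has_vector_derivative_def)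
  next
    have "continuous_on (X \<times> Y') (\<lambda>xy. partial \<i> f (P xy))"
      using assms(2) inU
      by (intro continuous_on_compose2[OF _ contP, of U]) (auto simp: C1_on_def P_def)
    then have "continuous_on (X \<times> Y') (\<lambda>xy. blinfun_scaleR_left (partial \<i> f (P xy)))"
      by (intro bounded_linear.continuous_on[OF bounded_linear_blinfun_scaleR_left])
    then show "continuous (at (Re z, Im z) within X \<times> Y')
        (\<lambda>(x, y). blinfun_scaleR_left (partial \<i> f (Complex x y)))"
      using z by (auto simp: continuous_on_eq_continuous_within P_def case_prod_unfold)
  qed (use e in \<open>auto simp: Y'_def\<close>)
  then have "((\<lambda>(x, y). F x y) has_derivative
      (\<lambda>(tx, ty). tx *\<^sub>R partial 1 f z + ty *\<^sub>R partial \<i> f z)) (at (Re z, Im z))"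
    using at_within_open[OF z opn] by simp
  moreover have "((\<lambda>w. (Re w, Im w)) has_derivative (\<lambda>w. (Re w, Im w))) (at z)"
    by (auto intro!: derivative_eq_intros)
  ultimately have "((\<lambda>(x, y). F x y) \<circ> (\<lambda>w. (Re w, Im w)) has_derivative
      (\<lambda>(tx, ty). tx *\<^sub>R partial 1 f z + ty *\<^sub>R partial \<i> f z) \<circ> (\<lambda>w. (Re w, Im w))) (at z)"
    by (intro diff_chain_at) auto
  then show ?thesis
    by (simp add: o_def F_def)
qed

text \<open>Two applications of the mean value theorem, first in direction \<open>d\<close>, then in
  direction \<open>e\<close>. The left-hand side is symmetric in \<open>d\<close> and
  \<open>e\<close>, while the right-hand side has the mixed derivative in one fixed order; this
  makes the two orders comparable.\<close>

lemma MVT_second_difference: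
  fixes h :: "complex \<Rightarrow> real"
  assumes d: "\<And>w. w \<in> S \<Longrightarrow> (\<lambda>t::real. h (w + of_real t * d)) differentiable (at 0)"
    and e: "\<And>w. w \<in> S \<Longrightarrow> (\<lambda>t::real. partial d h (w + of_real t * e)) differentiable (at 0)"
    and S: "\<And>a b. a \<in> {0..s} \<Longrightarrow> b \<in> {0..s} \<Longrightarrow> z + of_real a * d + of_real b * e \<in> S"
    and s: "s > 0"
  shows "\<exists>a\<in>{0..s}. \<exists>b\<in>{0..s}.
    h (z + of_real s * d + of_real s * e) - h (z + of_real s * d) - h (z + of_real s * e) + h z
      = s * s * partial e (partial d h) (z + of_real a * d + of_real b * e)"
proof -
  define \<phi> where "\<phi> = (\<lambda>t::real. h (z + of_real s * e + of_real t * d) - h (z + of_real t * d))"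
  define \<phi>' where "\<phi>' = (\<lambda>t::real. partial d h (z + of_real s * e + of_real t * d)
      - partial d h (z + of_real t * d))"
  have "\<exists>a\<in>{0<..<s}. \<phi> s - \<phi> 0 = (\<lambda>t. t * \<phi>' a) (s - 0)"
  proof (rule mvt_simple[OF s])
    fix t assume t: "0 \<le> t" "t \<le> s"
    have "z + of_real s * e + of_real t * d \<in> S" "z + of_real t * d \<in> S"
      using S[of t s] S[of t 0] t s by (simp_all add: algebra_simps)
    then have "(\<phi> has_vector_derivative \<phi>' t) (at t within {0..s})"
      unfolding \<phi>_def \<phi>'_def
      by (intro has_vector_derivative_diff has_vector_derivative_partial d)
    then show "(\<phi> has_derivative (\<lambda>u. u * \<phi>' t)) (at t within {0..s})"
      by (simp add: has_vector_derivative_def)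
  qed
  then obtain a where a: "a \<in> {0<..<s}" "\<phi> s - \<phi> 0 = s * \<phi>' a"
    by auto
  \<comment> \<open>The derivative \<open>\<phi>' a\<close> is itself an increment in direction
    \<open>e\<close>, namely that of \<open>partial d h\<close> from \<open>z + a d\<close>, so the
    mean value theorem applies a second time.\<close>
  define \<psi> where "\<psi> = (\<lambda>t::real. partial d h (z + of_real a * d + of_real t * e))"
  have "\<exists>b\<in>{0<..<s}. \<psi> s - \<psi> 0
      = (\<lambda>t. t * partial e (partial d h) (z + of_real a * d + of_real b * e)) (s - 0)"
  proof (rule mvt_simple[OF s])
    fix t assume t: "0 \<le> t" "t \<le> s"
    have "z + of_real a * d + of_real t * e \<in> S"
      using S[of a t] t a by simp
    then have "(\<psi> has_vector_derivative
        partial e (partial d h) (z + of_real a * d + of_real t * e)) (at t within {0..s})"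
      unfolding \<psi>_def by (intro has_vector_derivative_partial e)
    then show "(\<psi> has_derivative
        (\<lambda>u. u * partial e (partial d h) (z + of_real a * d + of_real t * e))) (at t within {0..s})"
      by (simp add: has_vector_derivative_def)
  qed
  then obtain b where b: "b \<in> {0<..<s}"
      "\<psi> s - \<psi> 0 = s * partial e (partial d h) (z + of_real a * d + of_real b * e)"
    by auto
  have "\<phi>' a = \<psi> s - \<psi> 0"
    by (simp add: \<phi>'_def \<psi>_def algebra_simps)
  moreover have "\<phi> s - \<phi> 0 =
      h (z + of_real s * d + of_real s * e) - h (z + of_real s * d) - h (z + of_real s * e) + h z"
    by (simp add: \<phi>_def algebra_simps)
  ultimately show ?thesis
    using a b by (intro bexI[of _ a] bexI[of _ b]) (auto simp: algebra_simps)
qed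

text \<open>Schwarz's theorem. On a small square at \<open>z\<close> the second difference is
  \<open>s * s\<close> times either mixed derivative, each taken at some point of the square. By
  continuity both values are close to those at \<open>z\<close>, so a gap between the latter is
  impossible.\<close>

lemma partial_commute:
  fixes h :: "complex \<Rightarrow> real"
  assumes "open U" "C2_on h U" "z \<in> U"
  shows "partial \<i> (partial 1 h) z = partial 1 (partial \<i> h) z"
proof (rule ccontr)
  define A where "A = partial \<i> (partial 1 h)"
  define B where "B = partial 1 (partial \<i> h)"
  assume "partial \<i> (partial 1 h) z \<noteq> partial 1 (partial \<i> h) z"
  then have pos: "\<bar>A z - B z\<bar> / 2 > 0"
    by (simp add: A_def B_def)
  have "continuous_on U A" "continuous_on U B"
    using assms(2) by (auto simp: A_def B_def C2_on_def C1_on_def)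
  then have "(A \<longlongrightarrow> A z) (nhds z)" "(B \<longlongrightarrow> B z) (nhds z)"
    using assms by (auto simp: continuous_on_eq_continuous_at isCont_def tendsto_at_iff_tendsto_nhds)
  then have "eventually (\<lambda>w. dist (A w) (A z) < \<bar>A z - B z\<bar> / 2
      \<and> dist (B w) (B z) < \<bar>A z - B z\<bar> / 2 \<and> w \<in> U) (nhds z)"
    using pos assms by (intro eventually_conj tendstoD eventually_nhds_in_open)
  then obtain r where r: "r > 0" "\<And>w. dist w z < r \<Longrightarrow> dist (A w) (A z) < \<bar>A z - B z\<bar> / 2
      \<and> dist (B w) (B z) < \<bar>A z - B z\<bar> / 2 \<and> w \<in> U"
    unfolding eventually_nhds_metric by blast
  \<comment> \<open>Two offsets of length at most \<open>r / 3\<close> each keep the point within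
    \<open>2 * r / 3 < r\<close> of \<open>z\<close>.\<close>
  define s where "s = r / 3"
  have s: "s > 0" using r by (simp add: s_def)
  have near: "dist (z + of_real a * 1 + of_real b * \<i>) z < r"
      "dist (z + of_real b * \<i> + of_real a * 1) z < r"
    if "a \<in> {0..s}" "b \<in> {0..s}" for a b
  proof -
    have "norm (of_real a + of_real b * \<i>) \<le> \<bar>a\<bar> + \<bar>b\<bar>"
      by (rule norm_triangle_le) (simp add: norm_mult)
    also have "\<dots> < r" using that r by (auto simp: s_def)
    finally show "dist (z + of_real a * 1 + of_real b * \<i>) z < r"
      by (simp add: dist_norm add.assoc)
    then show "dist (z + of_real b * \<i> + of_real a * 1) z < r"
      by (simp add: algebra_simps)
  qed
  have U: "z + of_real a * 1 + of_real b * \<i> \<in> U" "z + of_real b * \<i> + of_real a * 1 \<in> U"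
    if "a \<in> {0..s}" "b \<in> {0..s}" for a b
    using r(2)[OF near(1)[OF that]] r(2)[OF near(2)[OF that]] by blast+
  have h: "(\<lambda>t::real. h (w + of_real t * d)) differentiable (at 0)"
    if "w \<in> U" "d \<in> {1, \<i>}" for d w
    using assms(2) that unfolding C2_on_def C1_on_def by blast
  have h': "(\<lambda>t::real. partial d h (w + of_real t * e)) differentiable (at 0)"
    if "w \<in> U" "d \<in> {1, \<i>}" "e \<in> {1, \<i>}" for d e w
    using assms(2) that unfolding C2_on_def C1_on_def by blast
  have "\<exists>a\<in>{0..s}. \<exists>b\<in>{0..s}.
    h (z + of_real s * 1 + of_real s * \<i>) - h (z + of_real s * 1) - h (z + of_real s * \<i>) + h z
      = s * s * A (z + of_real a * 1 + of_real b * \<i>)"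
    unfolding A_def by (rule MVT_second_difference[OF h h' U(1) s]) auto
  then obtain a b where ab: "a \<in> {0..s}" "b \<in> {0..s}"
    "h (z + of_real s * 1 + of_real s * \<i>) - h (z + of_real s * 1) - h (z + of_real s * \<i>) + h z
      = s * s * A (z + of_real a * 1 + of_real b * \<i>)"
    by (elim bexE) (rule that)
  have "\<exists>b\<in>{0..s}. \<exists>a\<in>{0..s}.
    h (z + of_real s * \<i> + of_real s * 1) - h (z + of_real s * \<i>) - h (z + of_real s * 1) + h z
      = s * s * B (z + of_real b * \<i> + of_real a * 1)"
    unfolding B_def by (rule MVT_second_difference[OF h h' U(2) s]) auto
  then obtain a' b' where ab': "a' \<in> {0..s}" "b' \<in> {0..s}"
    "h (z + of_real s * \<i> + of_real s * 1) - h (z + of_real s * \<i>) - h (z + of_real s * 1) + h z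
      = s * s * B (z + of_real b' * \<i> + of_real a' * 1)"
    by (elim bexE) (rule that)
  have swap: "z + of_real s * \<i> + of_real s * 1 = z + of_real s * 1 + of_real s * \<i>"
    by simp
  have "s * s * A (z + of_real a * 1 + of_real b * \<i>)
      = s * s * B (z + of_real b' * \<i> + of_real a' * 1)"
    unfolding ab(3)[symmetric] ab'(3)[symmetric] swap by (simp only: diff_right_commute)
  then have "A (z + of_real a * 1 + of_real b * \<i>) = B (z + of_real b' * \<i> + of_real a' * 1)"
    using s by simp
  moreover have "dist (A (z + of_real a * 1 + of_real b * \<i>)) (A z) < \<bar>A z - B z\<bar> / 2"
    "dist (B (z + of_real b' * \<i> + of_real a' * 1)) (B z) < \<bar>A z - B z\<bar> / 2"
    using r(2)[OF near(1)[OF ab(1,2)]] r(2)[OF near(2)[OF ab'(1,2)]] by blast+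
  \<comment> \<open>\<open>A z\<close> and \<open>B z\<close> both lie within half of their own
    distance of one common value.\<close>
  ultimately have "dist (A z) (B z) < \<bar>A z - B z\<bar>"
    by (metis dist_triangle_half_r)
  then show False
    by (simp add: dist_real_def)
qed

section \<open>Power series of harmonic functions\<close>

text \<open>Twice the Wirtinger derivative of \<open>h\<close> with respect to \<open>z\<close>. By
  the Cauchy-Riemann equations it is the complex derivative of any holomorphic function with real
  part \<open>h\<close>.\<close>

definition conj_gradient :: "(complex \<Rightarrow> real) \<Rightarrow> complex \<Rightarrow> complex" where
  "conj_gradient h z = of_real (partial 1 h z) - \<i> * of_real (partial \<i> h z)"

lemma harmonic_conj_gradient_holomorphic:
  fixes h :: "complex \<Rightarrow> real"
  assumes "open U" "C2_on h U" "\<And>z. z \<in> U \<Longrightarrow> laplacian h z = 0"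
  shows "conj_gradient h holomorphic_on U"
proof (rule holomorphic_onI)
  fix z assume z: "z \<in> U"
  define p q where "p = partial 1 h" and "q = partial \<i> h"
  have C1: "C1_on p U" "C1_on q U"
    using assms(2) by (auto simp: C2_on_def p_def q_def)
  \<comment> \<open>The Cauchy-Riemann equations for \<open>p - \<i> q\<close>: one is the symmetry
    of the mixed derivatives of \<open>h\<close>, the other is the Laplace equation.\<close>
  have CR: "partial \<i> p z = partial 1 q z" "partial \<i> q z = - partial 1 p z"
    using partial_commute[OF assms(1,2) z] assms(3)[OF z] by (auto simp: p_def q_def laplacian_def)
  have "((\<lambda>w. complex_of_real (p w) - \<i> * complex_of_real (q w)) has_derivative
      (\<lambda>v. complex_of_real (Re v *\<^sub>R partial 1 p z + Im v *\<^sub>R partial \<i> p z)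
        - \<i> * complex_of_real (Re v *\<^sub>R partial 1 q z + Im v *\<^sub>R partial \<i> q z))) (at z)"
    by (intro has_derivative_diff has_derivative_of_real has_derivative_mult_right
        C1_on_has_derivative[OF assms(1) _ z] C1)
  \<comment> \<open>By these equations the real-linear total derivative is multiplication by a
    complex number.\<close>
  also have "(\<lambda>v. complex_of_real (Re v *\<^sub>R partial 1 p z + Im v *\<^sub>R partial \<i> p z)
        - \<i> * complex_of_real (Re v *\<^sub>R partial 1 q z + Im v *\<^sub>R partial \<i> q z))
      = (*) (Complex (partial 1 p z) (- partial 1 q z))"
    by (auto simp: fun_eq_iff complex_eq_iff CR algebra_simps)
  finally have "(conj_gradient h has_field_derivative Complex (partial 1 p z) (- partial 1 q z)) (at z)"
    by (simp add: has_field_derivative_def conj_gradient_def[abs_def] p_def q_def)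
  then show "conj_gradient h field_differentiable at z within U"
    using field_differentiable_def field_differentiable_at_within by blast
qed

lemma harmonic_eq_Re_primitive:
  fixes h :: "complex \<Rightarrow> real"
  assumes "convex S" "open S" "C2_on h S" "\<And>z. z \<in> S \<Longrightarrow> laplacian h z = 0" "z0 \<in> S"
  obtains g where "\<And>z. z \<in> S \<Longrightarrow> (g has_field_derivative conj_gradient h z) (at z)"
    "g z0 = of_real (h z0)" "\<And>z. z \<in> S \<Longrightarrow> h z = Re (g z)"
proof -
  obtain g0 where "\<And>z. z \<in> S \<Longrightarrow> (g0 has_field_derivative conj_gradient h z) (at z within S)"
    using holomorphic_convex_primitive'[OF assms(1,2)
        harmonic_conj_gradient_holomorphic[OF assms(2-4)]] by blast
  then have g0: "(g0 has_field_derivative conj_gradient h z) (at z)" if "z \<in> S" for z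
    using at_within_open[OF that assms(2)] that by metis
  \<comment> \<open>The constant is chosen so that \<open>g z0\<close> is exactly the real number
    \<open>h z0\<close>. This makes the constant difference \<open>Re (g z) - h z\<close> zero and
    fixes the Taylor coefficient of index 0.\<close>
  define g where "g = (\<lambda>z. g0 z - g0 z0 + of_real (h z0))"
  have g: "(g has_field_derivative conj_gradient h z) (at z)" if "z \<in> S" for z
    unfolding g_def by (auto intro!: derivative_eq_intros g0 that)
  have "\<exists>c. \<forall>z\<in>S. Re (g z) - h z = c"
  proof (rule has_derivative_zero_constant[OF assms(1)])
    fix z assume z: "z \<in> S"
    have "((\<lambda>z. Re (g z) - h z) has_derivative (\<lambda>v. Re (conj_gradient h z * v)
        - (Re v *\<^sub>R partial 1 h z + Im v *\<^sub>R partial \<i> h z))) (at z)"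
      using g[OF z] assms(3)
      by (intro has_derivative_diff has_derivative_Re C1_on_has_derivative[OF assms(2) _ z])
        (auto simp: has_field_derivative_def C2_on_def)
    \<comment> \<open>The real part of \<open>conj_gradient h z * v\<close> is the directional
      derivative of \<open>h\<close> along \<open>v\<close>, so the two terms cancel.\<close>
    then show "((\<lambda>z. Re (g z) - h z) has_derivative (\<lambda>v. 0)) (at z within S)"
      by (simp add: conj_gradient_def algebra_simps has_derivative_at_withinI)
  qed
  then obtain k where k: "\<And>z. z \<in> S \<Longrightarrow> Re (g z) - h z = k"
    by blast
  have g_z0: "g z0 = of_real (h z0)"
    by (simp add: g_def)
  then have "k = 0"
    using k[OF assms(5)] by simp
  then have "h z = Re (g z)" if "z \<in> S" for z
    using k[OF that] by simp
  with g g_z0 show ?thesis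
    by (rule that)
qed

text \<open>The quantifier order matters: one sequence serves every ball around \<open>z0\<close>
  inside \<open>U\<close>. The primitive is built anew on each ball, so the coefficients are defined
  from \<open>conj_gradient h\<close> instead, which does not refer to a ball.\<close>

lemma harmonic_power_series:
  fixes h :: "complex \<Rightarrow> real"
  assumes "open U" "C2_on h U" "\<And>z. z \<in> U \<Longrightarrow> laplacian h z = 0"
  shows "\<exists>a. \<forall>r>0. ball z0 r \<subseteq> U \<longrightarrow>
    (\<forall>z\<in>ball z0 r. (\<lambda>n. Re (a n * (z - z0) ^ n)) sums h z)"
proof -
  \<comment> \<open>These are the Taylor coefficients of the primitive. Differentiating it
    \<open>Suc m\<close> times is differentiating \<open>conj_gradient h\<close> only
    \<open>m\<close> times, but the factorial remains that of \<open>n = Suc m\<close>.\<close>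
  define a where "a = (\<lambda>n. case n of 0 \<Rightarrow> of_real (h z0)
    | Suc m \<Rightarrow> (deriv ^^ m) (conj_gradient h) z0 / fact n)"
  have "(\<lambda>n. Re (a n * (z - z0) ^ n)) sums h z"
    if r: "r > 0" "ball z0 r \<subseteq> U" and z: "z \<in> ball z0 r" for r z
  proof -
    have C2: "C2_on h (ball z0 r)"
      using assms(2) r(2) unfolding C2_on_def C1_on_def by (blast intro: continuous_on_subset)
    obtain g where g: "\<And>w. w \<in> ball z0 r \<Longrightarrow> (g has_field_derivative conj_gradient h w) (at w)"
      "g z0 = of_real (h z0)" "\<And>w. w \<in> ball z0 r \<Longrightarrow> h w = Re (g w)"
      using harmonic_eq_Re_primitive[OF convex_ball open_ball C2 assms(3)
          centre_in_ball[THEN iffD2, OF r(1)]] r(2) by blast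
    have "g holomorphic_on ball z0 r"
      unfolding holomorphic_on_open[OF open_ball] using g(1) by blast
    then have "(\<lambda>n. (deriv ^^ n) g z0 / fact n * (z - z0) ^ n) sums g z"
      using z by (rule holomorphic_power_series)
    moreover have "(deriv ^^ n) g z0 / fact n = a n" for n
    proof (cases n)
      case (Suc m)
      \<comment> \<open>Agreement of \<open>deriv g\<close> and \<open>conj_gradient h\<close> near
        \<open>z0\<close> is enough for their higher derivatives at \<open>z0\<close> to
        coincide.\<close>
      have "eventually (\<lambda>w. deriv g w = conj_gradient h w) (nhds z0)"
        using eventually_nhds_in_open[OF open_ball centre_in_ball[THEN iffD2, OF r(1)]]
        by eventually_elim (use g(1) in \<open>auto intro: DERIV_imp_deriv\<close>)
      then have "(deriv ^^ m) (deriv g) z0 = (deriv ^^ m) (conj_gradient h) z0"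
        by (intro higher_deriv_cong_ev refl)
      then show ?thesis
        by (simp add: Suc a_def funpow_Suc_right del: funpow.simps)
    qed (simp add: a_def g(2))
    ultimately have "(\<lambda>n. a n * (z - z0) ^ n) sums g z"
      by simp
    then show ?thesis
      unfolding g(3)[OF z] by (rule sums_Re)
  qed
  then show ?thesis by blast
qed

section \<open>The summands\<close>

lemma planar_minimal_surface_affine_graph:
  assumes "linear (f :: complex \<Rightarrow> real)"
  shows "planar_minimal_surface (graph_surface (\<lambda>z. f z + k))"
proof -
  let ?h = "\<lambda>z. f z + k"
  have p: "((\<lambda>t::real. ?h (z + of_real t * d)) has_vector_derivative f d) (at 0)" for z d
  proof -
    have "f (z + of_real t * d) = f z + t * f d" for t
      using linear_add[OF assms] linear_scale[OF assms, of t d] by (simp add: scaleR_conv_of_real)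
    then show ?thesis
      by (auto intro!: derivative_eq_intros simp flip: has_real_derivative_iff_has_vector_derivative)
  qed
  \<comment> \<open>The first partial derivatives are constant, hence all second ones
    vanish.\<close>
  then have p1: "partial d ?h = (\<lambda>z. f d)" for d
    by (auto simp: partial_eqI)
  have "C1_on ?h UNIV"
    unfolding C1_on_def p1 using differentiableI_vector[OF p]
    by (intro ballI conjI continuous_on_const)
  then have "C2_on ?h UNIV"
    by (simp add: C2_on_def p1 C1_on_const)
  moreover have "laplacian ?h z = 0" for z
    by (simp add: laplacian_def p1 partial_def)
  ultimately have "isotropic_minimal_surface (graph_surface ?h) UNIV"
    by (simp add: isotropic_minimal_graph_iff)
  \<comment> \<open>The equation \<open>height = f 1 * x + f \<i> * y + k\<close>, rewritten with
    all coordinates on one side; the entry \<open>- 1\<close> makes the normal vector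
    nonzero.\<close>
  moreover have "range (graph_surface ?h) = {p. vector [f 1, f \<i>, - 1] \<bullet> p = - k}"
  proof -
    have f: "f z = Re z * f 1 + Im z * f \<i>" for z
      using linear_add[OF assms, of "Re z *\<^sub>R 1" "Im z *\<^sub>R \<i>"]
        linear_scale[OF assms, of "Re z" 1] linear_scale[OF assms, of "Im z" \<i>]
      by (simp add: scaleR_conv_of_real mult.commute flip: complex_eq)
    have "p \<in> range (graph_surface ?h)" if "vector [f 1, f \<i>, - 1] \<bullet> p = - k" for p
      using that
      by (intro range_eqI[of _ _ "Complex (p $ 1) (p $ 2)"])
        (simp add: graph_surface_def vec_eq_iff forall_3 inner_vec_def sum_3 f[of "Complex _ _"]
          algebra_simps)
    moreover have "vector [f 1, f \<i>, - 1] \<bullet> graph_surface ?h z = - k" for z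
      using f[of z] by (simp add: graph_surface_def inner_vec_def sum_3 algebra_simps)
    ultimately show ?thesis by auto
  qed
  moreover have "vector [f 1, f \<i>, - 1] \<noteq> (0 :: real^3)"
    by (simp add: vec_eq_iff forall_3)
  ultimately show ?thesis
    unfolding planar_minimal_surface_def by blast
qed

text \<open>A number plus its conjugate is twice its real part. The factor 2 matches the one in the
  third Weierstrass integrand.\<close>

lemma term_surface_eq: "term_surface n c = graph_surface (\<lambda>z. Re (2 * c * z ^ n))"
proof -
  have "c * z ^ n + cnj c * cnj z ^ n = of_real (Re (2 * c * z ^ n))" for z
    using complex_add_cnj[of "c * z ^ n"] by (simp add: mult.assoc)
  then show ?thesis
    by (simp add: term_surface_def)
qed

lemma planar_minimal_surface_term_surface_0: "planar_minimal_surface (term_surface 0 c)"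
  using planar_minimal_surface_affine_graph[OF linear_zero, of "2 * Re c"]
  by (simp add: term_surface_def)

lemma planar_minimal_surface_term_surface_1: "planar_minimal_surface (term_surface 1 c)"
proof -
  have "linear (\<lambda>z. Re (c * z + cnj c * cnj z))"
    by (intro linearI) (auto simp: algebra_simps)
  from planar_minimal_surface_affine_graph[OF this, of 0] show ?thesis
    by (simp add: term_surface_def)
qed

lemma parallel_to_xy_plane_term_surface_0: "parallel_to_xy_plane (term_surface 0 c)"
proof -
  have "p \<in> range (term_surface 0 c)" if "p $ 3 = 2 * Re c" for p
    using that
    by (intro range_eqI[of _ _ "Complex (p $ 1) (p $ 2)"])
      (simp add: term_surface_def graph_surface_def vec_eq_iff forall_3)
  then have "range (term_surface 0 c) = {p. p $ 3 = 2 * Re c}"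
    by (auto simp: term_surface_def graph_surface_def)
  then show ?thesis
    unfolding parallel_to_xy_plane_def by blast
qed

lemma contour_integral_linepath_0_power:
  "contour_integral (linepath 0 z) (\<lambda>w. k * w ^ n) = k * z ^ Suc n / of_nat (Suc n)"
proof -
  have "((\<lambda>w. k * w ^ Suc n / of_nat (Suc n)) has_field_derivative k * w ^ n) (at w within UNIV)" for w
    by (auto intro!: derivative_eq_intros simp: field_simps simp del: of_nat_Suc power_Suc)
  from contour_integral_primitive[OF this valid_path_linepath[of 0 z]]
  show ?thesis
    by (intro contour_integral_unique) simp
qed

text \<open>With \<open>F = 1\<close> the first two integrals are \<open>z\<close> and
  \<open>- \<i> * z\<close>, whose real parts are \<open>Re z\<close> and \<open>Im z\<close>, so
  the Enneper surface is a graph. In the third, integrating \<open>w ^ (n - 1)\<close> divides by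
  \<open>n\<close>, which the scale \<open>of_nat n * c\<close> compensates.\<close>

lemma term_surface_eq_scaled_isotropic_enneper:
  assumes "n > 0"
  shows "term_surface n c = scaled_isotropic_enneper (n - 1) (of_nat n * c)"
proof
  fix z
  obtain m where n: "n = Suc m"
    using assms gr0_implies_Suc by blast
  have "contour_integral (linepath 0 z) (\<lambda>w. 2 * (of_nat n * c * w ^ m)) = 2 * c * z ^ n"
    using contour_integral_linepath_0_power[of z "2 * of_nat n * c" m]
    by (simp add: n mult.assoc del: of_nat_Suc)
  then show "term_surface n c z = scaled_isotropic_enneper (n - 1) (of_nat n * c) z"
    using contour_integral_linepath_0_power[of z 1 0] contour_integral_linepath_0_power[of z "- \<i>" 0]
    by (simp add: term_surface_eq graph_surface_def scaled_isotropic_enneper_def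
        weierstrass_enneper_def n mult.assoc del: of_nat_Suc power_Suc)
qed

text \<open>The added vector undoes the shift of the parameter in the first two coordinates, so the
  surface remains a graph over the same base points.\<close>

lemma translate_graph_surface:
  "translate_surface z0 (graph_surface f) = graph_surface (\<lambda>z. f (z - z0))"
  by (simp add: translate_surface_def graph_surface_def fun_eq_iff vec_eq_iff forall_3)

theorem theorem3p9:
  fixes h :: "complex \<Rightarrow> real" and U :: "complex set" and z0 :: complex
  assumes "open U" and "connected U" and "z0 \<in> U"
    and "isotropic_minimal_surface (graph_surface h) U"
  shows "\<exists>c :: nat \<Rightarrow> complex.
     planar_minimal_surface (term_surface 0 (c 0)) \<and>
     parallel_to_xy_plane (term_surface 0 (c 0)) \<and>
     planar_minimal_surface (term_surface 1 (c 1)) \<and>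
     (\<forall>n>1. term_surface n (c n) = scaled_isotropic_enneper (n - 1) (of_nat n * c n)) \<and>
     (\<forall>r>0. ball z0 r \<subseteq> U \<longrightarrow>
        decomposes_on (ball z0 r) (graph_surface h)
          (\<lambda>n. translate_surface z0 (term_surface n (c n))))"
proof -
  obtain a where a: "\<And>r z. r > 0 \<Longrightarrow> ball z0 r \<subseteq> U \<Longrightarrow> z \<in> ball z0 r \<Longrightarrow>
      (\<lambda>n. Re (a n * (z - z0) ^ n)) sums h z"
    using harmonic_power_series[of U h z0] assms(4) unfolding isotropic_minimal_graph_iff by blast
  \<comment> \<open>Halved because the height of \<open>term_surface n c\<close> is
    \<open>Re (2 * c * z ^ n)\<close>.\<close>
  define c where "c = (\<lambda>n. a n / 2)"
  have "decomposes_on (ball z0 r) (graph_surface h)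
      (\<lambda>n. translate_surface z0 (term_surface n (c n)))" if "r > 0" "ball z0 r \<subseteq> U" for r
    unfolding decomposes_on_def term_surface_eq translate_graph_surface
    using a[OF that]
    by (intro exI[of _ h] exI[of _ "\<lambda>n z. Re (a n * (z - z0) ^ n)"]) (auto simp: c_def)
  then show ?thesis
    using planar_minimal_surface_term_surface_0 planar_minimal_surface_term_surface_1
      parallel_to_xy_plane_term_surface_0 term_surface_eq_scaled_isotropic_enneper
    by (intro exI[of _ c]) auto
qed

end
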